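(* Suppose Assumption 1 holds and let $(f_t)_{t\in\mathbb N}$ be the online gradient descent iterates with step sizes satisfying $\lim_{t\to\infty}\eta_t=0$. Then there exist constants $\widehat C,\gamma>0$ independent of $t$ such that for every $t\in\mathbb N$, $$\mathbb E\big[\|f_t-f_H\|^2\big]\le\widehat C+\gamma\sum_{k=1}^t\eta_k^2\qquad\text{and}\qquad\mathbb E\big[\|\nabla\mathcal E(f_t)\|^2\big]\ge\frac{\big(\mathbb E[\mathcal E(f_t)-\mathcal E(f_H)]\big)^2}{\widehat C+\gamma\sum_{k=1}^t\eta_k^2}.$$
   Context: Setting: Let $\mathcal X\subset\mathbb R^d$, $\mathcal Y\subset\mathbb R$, $\mathcal Z=\mathcal X\times\mathcal Y$, and let $\rho$ be a Borel probability measure on $\mathcal Z$. Let $K:\mathcal X\times\mathcal X\to\mathbb R$ be a continuous, symmetric, positive semi-definite kernel with reproducing kernel Hilbert space $H_K$ (inner product $\langle\cdot,\cdot\rangle$, norm $\|\cdot\|$), $K_x:=K(x,\cdot)$, reproducing property $f(x)=\langle f,K_x\rangle$, and $\kappa:=\sup_{x\in\mathcal X}\sqrt{K(x,x)}<\infty$. Let $\phi:\mathcal Y\times\mathbb R\to[0,\infty)$ be a loss function, differentiable in its second argument, and write $\phi'(y,s)$ for its derivative with respect to $s$. The generalization error of $f:\mathcal X\to\mathbb R$ is $\mathcal E(f)=\int_{\mathcal Z}\phi(y,f(x))\,d\rho(x,y)$. It is assumed that a minimizer $f_H\in\arg\min_{f\in H_K}\mathcal E(f)$ exists and that $\max\{\sup_{y\in\mathcal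 Y}\phi(y,0),\ \sup_{(x,y)\in\mathcal Z}\phi(y,f_H(x))\}<\infty$. Let $z_t=(x_t,y_t)$, $t\in\mathbb N$, be i.i.d. samples from $\rho$, let $(\eta_t)_{t\in\mathbb N}$ be positive step sizes, and define the online gradient descent iterates by $f_1=0$ and $f_{t+1}=f_t-\eta_t\phi'(y_t,f_t(x_t))K_{x_t}$ for $t\in\mathbb N$ (so $f_t$ depends only on $z_1,\dots,z_{t-1}$). Assumption 1: for every $y\in\mathcal Y$, $\phi(y,\cdot)$ is convex and differentiable, and there are constants $\alpha\in(0,1]$, $L>0$ with $|\phi'(y,s)-\phi'(y,\tilde s)|\le L|s-\tilde s|^{\alpha}$ for all $s,\tilde s\in\mathbb R$, $y\in\mathcal Y$. $\nabla\mathcal E(f)=\mathbb E_{(x,y)\sim\rho}[\phi'(y,f(x))K_x]\in H_K$ denotes the gradient of $\mathcal E$ at $f\in H_K$. *)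

theory Defs
  imports "HOL-Probability.Probability"
begin

text \<open>The RKHS H_K is represented as a Hilbert space type 'h with feature map
  Phi (Phi x = K_x); a function f in H_K is evaluated as f(x) = inner f (Phi x),
  and K(x,x') = inner (Phi x) (Phi x').\<close>

definition gen_err ::
  "('a \<times> real) measure \<Rightarrow> (real \<Rightarrow> real \<Rightarrow> real) \<Rightarrow> ('a \<Rightarrow> 'h::real_inner) \<Rightarrow> 'h \<Rightarrow> real" where
  "gen_err \<rho> \<phi> \<Phi> f = (\<integral>z. \<phi> (snd z) (inner f (\<Phi> (fst z))) \<partial>\<rho>)"

definition grad_err ::
  "('a \<times> real) measure \<Rightarrow> (real \<Rightarrow> real \<Rightarrow> real) \<Rightarrow>
     ('a \<Rightarrow> 'h::{real_inner, complete_space, second_countable_topology}) \<Rightarrow> 'h \<Rightarrow> 'h" where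
  "grad_err \<rho> \<phi>' \<Phi> f = (\<integral>z. \<phi>' (snd z) (inner f (\<Phi> (fst z))) *\<^sub>R \<Phi> (fst z) \<partial>\<rho>)"

text \<open>Online gradient descent iterates: ogd ... z 1 = 0 and, for t >= 1,
  ogd ... z (t+1) = ogd ... z t - eta t * phi'(y_t, f_t(x_t)) K_{x_t}.
  The value at index 0 is an unused dummy.\<close>

primrec ogd ::
  "(real \<Rightarrow> real \<Rightarrow> real) \<Rightarrow> ('a \<Rightarrow> 'h::real_inner) \<Rightarrow> (nat \<Rightarrow> real) \<Rightarrow> (nat \<Rightarrow> 'a \<times> real) \<Rightarrow> nat \<Rightarrow> 'h" where
  "ogd \<phi>' \<Phi> \<eta> z 0 = 0"
| "ogd \<phi>' \<Phi> \<eta> z (Suc t) =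
     (if t = 0 then 0
      else ogd \<phi>' \<Phi> \<eta> z t
           - (\<eta> t * \<phi>' (snd (z t)) (inner (ogd \<phi>' \<Phi> \<eta> z t) (\<Phi> (fst (z t))))) *\<^sub>R \<Phi> (fst (z t)))"

end

theory Submission
  imports Defs
begin

text \<open>Write D_t for the mean squared distance E||f_t - f_H||^2. Expanding one step of the recursion,
  convexity of the loss bounds the cross term by the excess of the sample loss at f_t over that at f_H,
  and Hoelder continuity of the derivative together with nonnegativity of the loss gives the
  self-bounding estimate phi'^2 <= A (1 + phi), which controls the quadratic term. Since z_t is
  independent of f_t, the expected sample loss at f_t equals the expected generalization error of f_t,
  which dominates that of f_H. Hence D_{t+1} <= D_t + gamma eta_t^2 as soon as eta_t kappa^2 A <= 2,
  which holds eventually because eta_t -> 0; the finitely many earlier terms are absorbed into the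
  constant. For the second inequality, convexity gives E(f) - E(f_H) <= ||grad E(f)|| ||f - f_H||, and
  the Cauchy-Schwarz inequality in expectation turns this into the stated lower bound.\<close>

section \<open>Real analysis\<close>

lemma powr_le_1_plus:
  fixes x a :: real
  assumes "0 \<le> x" "0 < a" "a \<le> 1"
  shows "x powr a \<le> 1 + x"
proof (cases "x \<le> 1")
  case True
  then show ?thesis using assms powr_le1[of a x] by auto
next
  case False
  then have "x powr a \<le> x powr 1" using assms by (intro powr_mono) auto
  then show ?thesis using False by simp
qed

lemma norm_diff_scaleR_power2:
  fixes e v :: "'a::real_inner"
  shows "(norm (e - c *\<^sub>R v))\<^sup>2 = (norm e)\<^sup>2 - 2 * c * inner e v + c\<^sup>2 * (norm v)\<^sup>2"
  unfolding power2_norm_eq_inner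
  by (simp add: inner_diff_left inner_diff_right inner_commute[of v e] power2_eq_square algebra_simps)

lemma continuous_on_feature_map:
  fixes \<Phi> :: "'a::topological_space \<Rightarrow> 'h::real_inner"
  assumes K_cont: "continuous_on (X \<times> X) (\<lambda>p. inner (\<Phi> (fst p)) (\<Phi> (snd p)))"
  shows "continuous_on X \<Phi>"
  unfolding continuous_on_def
proof
  fix x0 assume x0: "x0 \<in> X"
  let ?K = "\<lambda>x x'. inner (\<Phi> x) (\<Phi> x')"
  have K_cont_at: "continuous_on X (\<lambda>x. ?K (a x) (b x))"
    if "continuous_on X a" "continuous_on X b" "a ` X \<subseteq> X" "b ` X \<subseteq> X" for a b
    using continuous_on_compose2[OF K_cont continuous_on_Pair[OF that(1,2)]] that(3,4) by auto
  have sq: "(norm (\<Phi> x - \<Phi> x0))\<^sup>2 = ?K x x - ?K x x0 - ?K x0 x + ?K x0 x0" for x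
    by (simp add: power2_norm_eq_inner inner_diff_left inner_diff_right)
  have "continuous_on X (\<lambda>x. (norm (\<Phi> x - \<Phi> x0))\<^sup>2)"
    unfolding sq using x0 by (intro continuous_intros K_cont_at) auto
  then have "((\<lambda>x. (norm (\<Phi> x - \<Phi> x0))\<^sup>2) \<longlongrightarrow> (norm (\<Phi> x0 - \<Phi> x0))\<^sup>2) (at x0 within X)"
    using x0 unfolding continuous_on_def by blast
  then have "((\<lambda>x. (norm (\<Phi> x - \<Phi> x0))\<^sup>2) \<longlongrightarrow> 0) (at x0 within X)"
    by simp
  then have "((\<lambda>x. sqrt ((norm (\<Phi> x - \<Phi> x0))\<^sup>2)) \<longlongrightarrow> 0) (at x0 within X)"
    using tendsto_real_sqrt by fastforce
  then show "(\<Phi> \<longlongrightarrow> \<Phi> x0) (at x0 within X)"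
    by (simp add: tendsto_norm_zero_iff LIM_zero_iff)
qed

lemma nonneg_ge_of_deriv_near:
  fixes f f' :: "real \<Rightarrow> real"
  assumes nonneg: "\<And>s. 0 \<le> f s"
    and deriv: "\<And>s. (f has_real_derivative f' s) (at s)"
    and u: "0 < u"
    and near: "\<And>\<xi>. \<bar>\<xi> - s\<bar> \<le> u \<Longrightarrow> \<bar>f' \<xi> - f' s\<bar> \<le> \<bar>f' s\<bar> / 2"
  shows "u * \<bar>f' s\<bar> / 2 \<le> f s"
proof (cases "f' s \<ge> 0")
  case True
  obtain \<xi> where \<xi>: "s - u < \<xi>" "\<xi> < s" "f s - f (s - u) = (s - (s - u)) * f' \<xi>"
    using MVT2[of "s - u" s f f'] u deriv by auto
  have "\<bar>f' \<xi> - f' s\<bar> \<le> \<bar>f' s\<bar> / 2" using near \<xi> by auto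
  then have "\<bar>f' s\<bar> / 2 \<le> f' \<xi>" using True abs_ge_minus_self[of "f' \<xi> - f' s"] by linarith
  then have "u * (\<bar>f' s\<bar> / 2) \<le> u * f' \<xi>" using u by (intro mult_left_mono) auto
  then show ?thesis using \<xi>(3) nonneg[of "s - u"] by simp
next
  case False
  obtain \<xi> where \<xi>: "s < \<xi>" "\<xi> < s + u" "f (s + u) - f s = (s + u - s) * f' \<xi>"
    using MVT2[of s "s + u" f f'] u deriv by auto
  have "\<bar>f' \<xi> - f' s\<bar> \<le> \<bar>f' s\<bar> / 2" using near \<xi> by auto
  then have "f' \<xi> \<le> - \<bar>f' s\<bar> / 2" using False abs_ge_self[of "f' \<xi> - f' s"] by linarith
  then have "u * f' \<xi> \<le> u * (- \<bar>f' s\<bar> / 2)" using u by (intro mult_left_mono) auto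
  then show ?thesis using \<xi>(3) nonneg[of "s + u"] by simp
qed

lemma holder_deriv_sq_le:
  fixes f f' :: "real \<Rightarrow> real"
  assumes nonneg: "\<And>s. 0 \<le> f s"
    and deriv: "\<And>s. (f has_real_derivative f' s) (at s)"
    and holder: "\<And>s s'. \<bar>f' s - f' s'\<bar> \<le> L * \<bar>s - s'\<bar> powr \<alpha>"
    and \<alpha>: "0 < \<alpha>" "\<alpha> \<le> 1" and L: "0 < L"
  shows "(f' s)\<^sup>2 \<le> (1 + 2 * (2 * L) powr (1 / \<alpha>)) * (1 + f s)"
proof -
  define g where "g = \<bar>f' s\<bar>"
  define c where "c = (2 * L) powr (1 / \<alpha>)"
  have c: "0 < c" using L by (simp add: c_def)
  have rhs: "max 1 (2 * c * f s) \<le> (1 + 2 * c) * (1 + f s)"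
    using c nonneg[of s] by (simp add: algebra_simps)
  have "g\<^sup>2 \<le> max 1 (2 * c * f s)"
  proof (cases "g \<le> 1")
    case True
    then show ?thesis by (simp add: g_def abs_square_le_1 le_max_iff_disj)
  next
    case False
    \<comment> \<open>u is chosen so that L u powr \<alpha> = g / 2.\<close>
    define u where "u = (g / (2 * L)) powr (1 / \<alpha>)"
    have u: "0 < u" using False L by (simp add: u_def)
    have near: "\<bar>f' \<xi> - f' s\<bar> \<le> g / 2" if "\<bar>\<xi> - s\<bar> \<le> u" for \<xi>
    proof -
      have "\<bar>\<xi> - s\<bar> powr \<alpha> \<le> u powr \<alpha>" using that \<alpha> by (intro powr_mono2) auto
      also have "u powr \<alpha> = g / (2 * L)" using False L \<alpha> by (simp add: u_def powr_powr)
      finally have "L * \<bar>\<xi> - s\<bar> powr \<alpha> \<le> g / 2" using L by (simp add: field_simps)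
      then show ?thesis using holder[of \<xi> s] by linarith
    qed
    have f_ge: "u * g / 2 \<le> f s"
      using nonneg_ge_of_deriv_near[OF nonneg deriv u] near unfolding g_def by blast
    have "g \<le> g powr (1 / \<alpha>)"
      using False \<alpha> powr_mono[of 1 "1 / \<alpha>" g] by (simp add: field_simps)
    also have "g powr (1 / \<alpha>) = c * u"
      using False L by (simp add: u_def c_def powr_divide)
    finally have "g * g \<le> c * u * g" using False by (intro mult_right_mono) auto
    also have "\<dots> \<le> 2 * c * f s" using f_ge c by (simp add: field_simps)
    finally show ?thesis by (simp add: power2_eq_square)
  qed
  then have "(f' s)\<^sup>2 \<le> max 1 (2 * c * f s)" by (simp add: g_def)
  from order_trans[OF this rhs] show ?thesis unfolding c_def .
qed

section \<open>Measure theory\<close>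

lemma measurable_comp_restricted_uncurry:
  fixes g :: "real \<Rightarrow> real \<Rightarrow> real" and a b :: "'a \<Rightarrow> real"
  assumes g: "(\<lambda>p. g (fst p) (snd p)) \<in> borel_measurable (restrict_space borel (Y \<times> UNIV))"
    and a: "a \<in> borel_measurable M" and b: "b \<in> borel_measurable M"
    and aY: "\<And>x. x \<in> space M \<Longrightarrow> a x \<in> Y"
  shows "(\<lambda>x. g (a x) (b x)) \<in> borel_measurable M"
proof -
  have "(\<lambda>x. (a x, b x)) \<in> measurable M (restrict_space borel (Y \<times> UNIV))"
    using aY by (intro measurable_restrict_space2 borel_measurable_Pair a b) auto
  from measurable_compose[OF this g] show ?thesis by simp
qed

lemma borel_measurable_derivative_family:
  fixes \<phi> \<phi>' :: "real \<Rightarrow> real \<Rightarrow> real"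
  assumes \<phi>: "(\<lambda>p. \<phi> (fst p) (snd p)) \<in> borel_measurable (restrict_space borel (Y \<times> UNIV))"
    and deriv: "\<forall>y\<in>Y. \<forall>s. (\<phi> y has_real_derivative \<phi>' y s) (at s)"
  shows "(\<lambda>p. \<phi>' (fst p) (snd p)) \<in> borel_measurable (restrict_space borel (Y \<times> UNIV))"
    (is "_ \<in> borel_measurable ?M")
proof (rule borel_measurable_LIMSEQ_real)
  fix p assume "p \<in> space ?M"
  then have "(\<phi> (fst p) has_real_derivative \<phi>' (fst p) (snd p)) (at (snd p))"
    using deriv by (auto simp: space_restrict_space)
  then have "((\<lambda>h. (\<phi> (fst p) (snd p + h) - \<phi> (fst p) (snd p)) / h) \<longlongrightarrow> \<phi>' (fst p) (snd p)) (at 0)"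
    by (simp add: DERIV_def)
  moreover have "filterlim (\<lambda>i. 1 / real (Suc i)) (at 0) sequentially"
    by (intro tendsto_imp_filterlim_at_right[THEN filterlim_at_split[THEN iffD1], THEN conjunct2]
        filterlim_at[THEN iffD2] conjI eventually_sequentiallyI[of 0] LIMSEQ_Suc lim_const_over_n) auto
  ultimately have "((\<lambda>i. (\<phi> (fst p) (snd p + 1 / real (Suc i)) - \<phi> (fst p) (snd p)) / (1 / real (Suc i)))
      \<longlongrightarrow> \<phi>' (fst p) (snd p)) sequentially"
    by (rule filterlim_compose)
  then show "(\<lambda>i. (\<phi> (fst p) (snd p + 1 / real (Suc i)) - \<phi> (fst p) (snd p)) * real (Suc i))
      \<longlonglongrightarrow> \<phi>' (fst p) (snd p)"
    by simp
next
  fix i :: nat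
  have fst: "fst \<in> borel_measurable ?M" and shift: "(\<lambda>p. snd p + c) \<in> borel_measurable ?M" for c :: real
    by (auto intro!: measurable_restrict_space1 borel_measurable_continuous_onI continuous_intros)
  have Y: "\<And>p. p \<in> space ?M \<Longrightarrow> fst p \<in> Y" by (auto simp: space_restrict_space)
  show "(\<lambda>p. (\<phi> (fst p) (snd p + 1 / real (Suc i)) - \<phi> (fst p) (snd p)) * real (Suc i))
      \<in> borel_measurable ?M"
    using measurable_comp_restricted_uncurry[OF \<phi> fst shift Y, of "1 / real (Suc i)"]
      measurable_comp_restricted_uncurry[OF \<phi> fst shift Y, of 0]
    by (intro borel_measurable_times borel_measurable_diff borel_measurable_const) auto
qed

lemma (in prob_space) nn_integral_indep_var:
  assumes ind: "indep_var S X T Y" and h: "h \<in> borel_measurable (S \<Otimes>\<^sub>M T)"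
  shows "(\<integral>\<^sup>+\<omega>. h (X \<omega>, Y \<omega>) \<partial>M) = (\<integral>\<^sup>+x. \<integral>\<^sup>+y. h (x, y) \<partial>distr M T Y \<partial>distr M S X)"
proof -
  have X: "random_variable S X" and Y: "random_variable T Y"
    using ind by (auto dest: indep_var_rv1 indep_var_rv2)
  interpret Y: prob_space "distr M T Y" by (rule prob_space_distr[OF Y])
  have "(\<integral>\<^sup>+\<omega>. h (X \<omega>, Y \<omega>) \<partial>M) = (\<integral>\<^sup>+p. h p \<partial>distr M (S \<Otimes>\<^sub>M T) (\<lambda>\<omega>. (X \<omega>, Y \<omega>)))"
    by (rule nn_integral_distr[symmetric]) (auto intro!: measurable_Pair X Y h)
  also have "\<dots> = (\<integral>\<^sup>+p. h p \<partial>(distr M S X \<Otimes>\<^sub>M distr M T Y))"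
    using ind unfolding indep_var_distribution_eq by simp
  also have "\<dots> = (\<integral>\<^sup>+x. \<integral>\<^sup>+y. h (x, y) \<partial>distr M T Y \<partial>distr M S X)"
    using h by (intro Y.nn_integral_fst[symmetric]) (simp cong: measurable_cong_sets)
  finally show ?thesis .
qed

lemma nn_integral_sq_le_of_le_mult:
  fixes d e g :: "'a \<Rightarrow> real"
  assumes d: "d \<in> borel_measurable M" and e: "e \<in> borel_measurable M"
    and le: "\<And>x. d x \<le> g x * e x" and e_nonneg: "\<And>x. 0 \<le> e x" and g_nonneg: "\<And>x. 0 \<le> g x"
  shows "(\<integral>\<^sup>+x. ennreal (d x) \<partial>M)\<^sup>2 \<le> (\<integral>\<^sup>+x. ennreal ((e x)\<^sup>2) \<partial>M) * (\<integral>\<^sup>+x. ennreal ((g x)\<^sup>2) \<partial>M)"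
proof -
  \<comment> \<open>g need not be measurable; the quotient h = max 0 d / e is, and h \<le> g.\<close>
  define h where "h x = max 0 (d x) / e x" for x
  have h_nonneg: "0 \<le> h x" for x unfolding h_def using e_nonneg by simp
  have h_le: "h x \<le> g x" for x
    using le[of x] e_nonneg[of x] g_nonneg[of x]
    by (cases "e x = 0") (auto simp: h_def pos_divide_le_eq)
  have d_eq: "ennreal (d x) = ennreal (e x) * ennreal (h x)" for x
  proof (cases "e x = 0")
    case True
    then show ?thesis using le[of x] by (simp add: ennreal_neg)
  next
    case False
    then have "e x * h x = max 0 (d x)" unfolding h_def by simp
    then show ?thesis
      by (simp add: ennreal_mult'[OF e_nonneg, symmetric] ennreal_neg max_def split: if_splits)
  qed
  have h: "h \<in> borel_measurable M" unfolding h_def using d e by measurable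
  have "(\<integral>\<^sup>+x. ennreal (d x) \<partial>M)\<^sup>2 \<le> (\<integral>\<^sup>+x. ennreal (e x) ^ 2 \<partial>M) * (\<integral>\<^sup>+x. ennreal (h x) ^ 2 \<partial>M)"
    unfolding d_eq by (intro Cauchy_Schwarz_nn_integral measurable_compose[OF _ measurable_ennreal] e h)
  also have "\<dots> \<le> (\<integral>\<^sup>+x. ennreal ((e x)\<^sup>2) \<partial>M) * (\<integral>\<^sup>+x. ennreal ((g x)\<^sup>2) \<partial>M)"
    using h_nonneg h_le e_nonneg
    by (intro mult_mono nn_integral_mono) (auto simp: ennreal_power power_mono)
  finally show ?thesis .
qed

lemma le_partial_sums_if_eventually_increments:
  fixes D a :: "nat \<Rightarrow> real"
  assumes step: "eventually (\<lambda>t. D (Suc t) \<le> D t + \<gamma> * a t) sequentially"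
    and \<gamma>: "0 \<le> \<gamma>" and a: "\<And>k. 0 \<le> a k"
  shows "\<exists>C\<ge>0. \<forall>t\<ge>1. D t \<le> C + \<gamma> * (\<Sum>k=1..t. a k)"
proof -
  obtain N0 where step_N0: "\<And>t. N0 \<le> t \<Longrightarrow> D (Suc t) \<le> D t + \<gamma> * a t"
    using step unfolding eventually_sequentially by blast
  define N where "N = Suc N0"
  have N: "1 \<le> N" and step_N: "\<And>t. N \<le> t \<Longrightarrow> D (Suc t) \<le> D t + \<gamma> * a t"
    using step_N0 unfolding N_def by auto
  define C where "C = (\<Sum>k\<le>N. \<bar>D k\<bar>)"
  have initial: "D t \<le> C" if "t \<le> N" for t
    using that member_le_sum[of t "{..N}" "\<lambda>k. \<bar>D k\<bar>"] unfolding C_def by fastforce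
  have tail: "D t \<le> C + \<gamma> * (\<Sum>k\<in>{N..<t}. a k)" if "N \<le> t" for t
    using that
  proof (induction t rule: dec_induct)
    case base
    then show ?case using initial[of N] by simp
  next
    case (step t)
    then show ?case
      using step_N[of t] by (simp add: sum.atLeastLessThan_Suc algebra_simps)
  qed
  have "D t \<le> C + \<gamma> * (\<Sum>k=1..t. a k)" if "1 \<le> t" for t
  proof (cases "t \<le> N")
    case True
    have "0 \<le> \<gamma> * (\<Sum>k=1..t. a k)" using \<gamma> a by (simp add: sum_nonneg)
    then show ?thesis using initial[OF True] by linarith
  next
    case False
    have "(\<Sum>k\<in>{N..<t}. a k) \<le> (\<Sum>k=1..t. a k)" using N a by (intro sum_mono2) auto
    then have "\<gamma> * (\<Sum>k\<in>{N..<t}. a k) \<le> \<gamma> * (\<Sum>k=1..t. a k)" using \<gamma> by (rule mult_left_mono)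
    then show ?thesis using tail[of t] False by linarith
  qed
  moreover have "0 \<le> C" unfolding C_def by (simp add: sum_nonneg)
  ultimately show ?thesis by blast
qed

text \<open>The library proves these two lemmas for the class banach; a type variable of sort
  {real_normed_vector, complete_space} is not of that class, so they are repeated for the Hilbert space.\<close>

lemma integrableI_sequence_complete:
  fixes f :: "'a \<Rightarrow> 'b::{real_normed_vector, complete_space, second_countable_topology}"
  assumes f: "f \<in> borel_measurable M"
    and s: "\<And>i. Bochner_Integration.simple_bochner_integrable M (s i)"
    and lim: "(\<lambda>i. \<integral>\<^sup>+x. norm (f x - s i x) \<partial>M) \<longlonglongrightarrow> 0" (is "?S \<longlonglongrightarrow> 0")
  shows "integrable M f"
proof -
  let ?s = "\<lambda>n. Bochner_Integration.simple_bochner_integral M (s n)"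
  have "Cauchy ?s"
  proof (rule metric_CauchyI)
    fix e :: real assume "0 < e"
    then obtain N where N: "\<And>n. N \<le> n \<Longrightarrow> ?S n < e / 2"
      using order_tendstoD(2)[OF lim, of "ennreal (e / 2)"] by (auto simp: eventually_sequentially)
    have "dist (?s m) (?s n) < e" if "N \<le> m" "N \<le> n" for m n
    proof -
      have "norm (?s n - ?s m) \<le> ?S n + ?S m"
        by (intro simple_bochner_integral_bounded s f)
      also have "\<dots> < ennreal (e / 2) + e / 2"
        by (intro add_strict_mono N that)
      also have "\<dots> = e" using \<open>0 < e\<close> by (simp flip: ennreal_plus)
      finally show ?thesis
        using \<open>0 < e\<close> by (simp add: dist_norm ennreal_less_iff norm_minus_commute)
    qed
    then show "\<exists>N. \<forall>m\<ge>N. \<forall>n\<ge>N. dist (?s m) (?s n) < e" by blast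
  qed
  then obtain x where "?s \<longlonglongrightarrow> x" using Cauchy_convergent_iff convergent_def by blast
  then show ?thesis
    by (rule integrable.intros[OF has_bochner_integral.intros[OF f s lim]])
qed

lemma integrableI_bounded_complete:
  fixes f :: "'a \<Rightarrow> 'b::{real_normed_vector, complete_space, second_countable_topology}"
  assumes f[measurable]: "f \<in> borel_measurable M" and fin: "(\<integral>\<^sup>+x. norm (f x) \<partial>M) < \<infinity>"
  shows "integrable M f"
proof -
  from borel_measurable_implies_sequence_metric[OF f, of 0] obtain s where
    s: "\<And>i. simple_function M (s i)" and
    pointwise: "\<And>x. x \<in> space M \<Longrightarrow> (\<lambda>i. s i x) \<longlonglongrightarrow> f x" and
    bound: "\<And>i x. x \<in> space M \<Longrightarrow> norm (s i x) \<le> 2 * norm (f x)"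
    by simp metis
  have fin_2f: "(\<integral>\<^sup>+x. ennreal (2 * norm (f x)) \<partial>M) < \<infinity>"
    using fin by (simp add: nn_integral_cmult ennreal_mult ennreal_mult_less_top)
  show ?thesis
  proof (rule integrableI_sequence_complete[OF f])
    show "Bochner_Integration.simple_bochner_integrable M (s i)" for i
    proof (rule simple_bochner_integrableI_bounded[OF s])
      have "(\<integral>\<^sup>+x. norm (s i x) \<partial>M) \<le> (\<integral>\<^sup>+x. ennreal (2 * norm (f x)) \<partial>M)"
        by (intro nn_integral_mono) (simp add: bound)
      then show "(\<integral>\<^sup>+x. norm (s i x) \<partial>M) < \<infinity>" using fin_2f by simp
    qed
    show "(\<lambda>i. \<integral>\<^sup>+x. ennreal (norm (f x - s i x)) \<partial>M) \<longlonglongrightarrow> 0"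
      using bound pointwise s fin_2f
      by (intro nn_integral_dominated_convergence_norm[where w="\<lambda>x. 2 * norm (f x)"])
        (auto intro: borel_measurable_simple_function)
  qed
qed

section \<open>Online gradient descent\<close>

text \<open>The hypotheses of the theorem, except the density of the span of the features, which the
  argument never uses.\<close>

locale ogd_setting =
  fixes X :: "'a::euclidean_space set" and Y :: "real set"
    and \<rho> :: "('a \<times> real) measure"
    and \<Phi> :: "'a \<Rightarrow> 'h::{real_inner, complete_space, second_countable_topology}"
    and \<phi> \<phi>' :: "real \<Rightarrow> real \<Rightarrow> real"
    and fH :: 'h and \<eta> :: "nat \<Rightarrow> real" and \<alpha> L :: real
    and P :: "'w measure" and Z :: "nat \<Rightarrow> 'w \<Rightarrow> 'a \<times> real"
  assumes rho_prob: "prob_space \<rho>"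
    and rho_sets: "sets \<rho> = sets (restrict_space borel (X \<times> Y))"
    and K_cont: "continuous_on (X \<times> X) (\<lambda>p. inner (\<Phi> (fst p)) (\<Phi> (snd p)))"
    and kappa: "\<exists>\<kappa>. \<forall>x\<in>X. norm (\<Phi> x) \<le> \<kappa>"
    and phi_meas: "(\<lambda>p. \<phi> (fst p) (snd p)) \<in> borel_measurable (restrict_space borel (Y \<times> UNIV))"
    and phi_nonneg: "\<forall>y\<in>Y. \<forall>s. 0 \<le> \<phi> y s"
    and phi_deriv: "\<forall>y\<in>Y. \<forall>s. (\<phi> y has_real_derivative \<phi>' y s) (at s)"
    and phi_convex: "\<forall>y\<in>Y. convex_on UNIV (\<phi> y)"
    and alpha: "0 < \<alpha>" "\<alpha> \<le> 1" and L: "0 < L"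
    and holder: "\<forall>y\<in>Y. \<forall>s s'. \<bar>\<phi>' y s - \<phi>' y s'\<bar> \<le> L * \<bar>s - s'\<bar> powr \<alpha>"
    and fH_min: "\<forall>f. gen_err \<rho> \<phi> \<Phi> fH \<le> gen_err \<rho> \<phi> \<Phi> f"
    and bounded: "\<exists>B. (\<forall>y\<in>Y. \<phi> y 0 \<le> B) \<and> (\<forall>x\<in>X. \<forall>y\<in>Y. \<phi> y (inner fH (\<Phi> x)) \<le> B)"
    and P_prob: "prob_space P"
    and Z_indep: "prob_space.indep_vars P (\<lambda>_. \<rho>) Z UNIV"
    and Z_distr: "\<forall>t. distr P \<rho> (Z t) = \<rho>"
    and eta_pos: "\<forall>t. 0 < \<eta> t"
    and eta_lim: "\<eta> \<longlonglongrightarrow> 0"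
begin

definition feature_bound :: real where
  "feature_bound = max 1 (SOME \<kappa>. \<forall>x\<in>X. norm (\<Phi> x) \<le> \<kappa>)"

lemma norm_feature_le: "x \<in> X \<Longrightarrow> norm (\<Phi> x) \<le> feature_bound"
  using someI_ex[OF kappa] unfolding feature_bound_def by force

lemma one_le_feature_bound: "1 \<le> feature_bound"
  unfolding feature_bound_def by simp

lemma abs_eval_le: "x \<in> X \<Longrightarrow> \<bar>inner f (\<Phi> x)\<bar> \<le> feature_bound * norm f"
  using Cauchy_Schwarz_ineq2[of f "\<Phi> x"] norm_feature_le[of x]
  by (smt (verit) mult.commute mult_left_mono norm_ge_zero)

definition loss_bound :: real where
  "loss_bound = max 0 (SOME B. (\<forall>y\<in>Y. \<phi> y 0 \<le> B) \<and> (\<forall>x\<in>X. \<forall>y\<in>Y. \<phi> y (inner fH (\<Phi> x)) \<le> B))"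

lemma le_loss_bound:
  "y \<in> Y \<Longrightarrow> \<phi> y 0 \<le> loss_bound"
  "x \<in> X \<Longrightarrow> y \<in> Y \<Longrightarrow> \<phi> y (inner fH (\<Phi> x)) \<le> loss_bound"
  "0 \<le> loss_bound"
  using someI_ex[OF bounded] unfolding loss_bound_def by force+

definition self_bound_const :: real where
  "self_bound_const = 1 + 2 * (2 * L) powr (1 / \<alpha>)"

lemma one_le_self_bound_const: "1 \<le> self_bound_const"
  unfolding self_bound_const_def by simp

lemma deriv_sq_le_loss: "y \<in> Y \<Longrightarrow> (\<phi>' y s)\<^sup>2 \<le> self_bound_const * (1 + \<phi> y s)"
  unfolding self_bound_const_def
  by (rule holder_deriv_sq_le[of "\<phi> y"]) (use phi_nonneg phi_deriv holder alpha L in auto)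

definition deriv_growth :: "real \<Rightarrow> real" where
  "deriv_growth r = sqrt (self_bound_const * (1 + loss_bound)) + L * (1 + r)"

lemma deriv_growth_nonneg: "0 \<le> r \<Longrightarrow> 0 \<le> deriv_growth r"
  unfolding deriv_growth_def using L one_le_self_bound_const le_loss_bound(3) by simp

lemma abs_deriv_le:
  assumes y: "y \<in> Y" and s: "\<bar>s\<bar> \<le> r"
  shows "\<bar>\<phi>' y s\<bar> \<le> deriv_growth r"
proof -
  have "(\<phi>' y 0)\<^sup>2 \<le> self_bound_const * (1 + loss_bound)"
    using deriv_sq_le_loss[OF y, of 0] le_loss_bound(1)[OF y] one_le_self_bound_const
    by (smt (verit) mult_left_mono)
  then have "\<bar>\<phi>' y 0\<bar> \<le> sqrt (self_bound_const * (1 + loss_bound))"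
    using real_sqrt_le_mono by fastforce
  moreover have "\<bar>\<phi>' y s - \<phi>' y 0\<bar> \<le> L * (1 + r)"
  proof -
    have "\<bar>\<phi>' y s - \<phi>' y 0\<bar> \<le> L * \<bar>s\<bar> powr \<alpha>" using bspec[OF holder y] by (metis diff_zero)
    also have "\<dots> \<le> L * (1 + r)"
      using L alpha s powr_le_1_plus[of "\<bar>s\<bar>" \<alpha>] by (intro mult_left_mono) auto
    finally show ?thesis .
  qed
  ultimately show ?thesis unfolding deriv_growth_def by linarith
qed

lemma loss_tangent: "y \<in> Y \<Longrightarrow> \<phi>' y a * (b - a) \<le> \<phi> y b - \<phi> y a"
  using phi_convex phi_deriv by (intro convex_on_imp_above_tangent[where A=UNIV]) auto

lemma loss_le:
  assumes y: "y \<in> Y" and s: "\<bar>s\<bar> \<le> r"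
  shows "\<phi> y s \<le> loss_bound + r * deriv_growth r"
proof -
  have "\<phi> y s \<le> \<phi> y 0 + \<phi>' y s * s" using loss_tangent[OF y, of s 0] by simp
  also have "\<phi>' y s * s \<le> r * deriv_growth r"
    using abs_deriv_le[OF y s] s abs_mult[of "\<phi>' y s" s]
    by (smt (verit) abs_ge_self mult_mono mult.commute abs_ge_zero)
  finally show ?thesis using le_loss_bound(1)[OF y] by linarith
qed

abbreviation loss :: "'a \<times> real \<Rightarrow> 'h \<Rightarrow> real" where
  "loss z f \<equiv> \<phi> (snd z) (inner f (\<Phi> (fst z)))"

definition loss_sup :: "real \<Rightarrow> real" where
  "loss_sup r = loss_bound + feature_bound * r * deriv_growth (feature_bound * r)"

lemma loss_bounds: "z \<in> X \<times> Y \<Longrightarrow> norm f \<le> r \<Longrightarrow> 0 \<le> loss z f \<and> loss z f \<le> loss_sup r"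
proof -
  assume z: "z \<in> X \<times> Y" and r: "norm f \<le> r"
  have "\<bar>inner f (\<Phi> (fst z))\<bar> \<le> feature_bound * norm f" using abs_eval_le z by auto
  also have "\<dots> \<le> feature_bound * r" using r one_le_feature_bound by (intro mult_left_mono) auto
  finally have "\<bar>inner f (\<Phi> (fst z))\<bar> \<le> feature_bound * r" .
  then show ?thesis
    using loss_le[of "snd z"] phi_nonneg z unfolding loss_sup_def by (auto simp: mem_Times_iff)
qed

lemma space_rho: "space \<rho> = X \<times> Y"
  using sets_eq_imp_space_eq[OF rho_sets] by (simp add: space_restrict_space)

lemma sample_mem: "a \<in> measurable M \<rho> \<Longrightarrow> w \<in> space M \<Longrightarrow> a w \<in> X \<times> Y"
  using measurable_space[of a M \<rho> w] space_rho by simp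

lemma measurable_feature_sample: "a \<in> measurable M \<rho> \<Longrightarrow> (\<lambda>w. \<Phi> (fst (a w))) \<in> borel_measurable M"
proof (erule measurable_compose)
  have "continuous_on (X \<times> Y) (\<lambda>z. \<Phi> (fst z))"
    using continuous_on_feature_map[OF K_cont] by (rule continuous_on_compose2) (auto intro: continuous_intros)
  then show "(\<lambda>z. \<Phi> (fst z)) \<in> borel_measurable \<rho>"
    unfolding measurable_cong_sets[OF rho_sets refl] by (rule borel_measurable_continuous_on_restrict)
qed

lemma measurable_label_sample: "a \<in> measurable M \<rho> \<Longrightarrow> (\<lambda>w. snd (a w)) \<in> borel_measurable M"
proof (erule measurable_compose)
  show "snd \<in> borel_measurable \<rho>"
    unfolding measurable_cong_sets[OF rho_sets refl]
    by (rule borel_measurable_continuous_on_restrict) (auto intro: continuous_intros)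
qed

lemma measurable_loss:
  "a \<in> measurable M \<rho> \<Longrightarrow> b \<in> borel_measurable M \<Longrightarrow> (\<lambda>w. loss (a w) (b w)) \<in> borel_measurable M"
  by (intro measurable_comp_restricted_uncurry[OF phi_meas] measurable_label_sample
      borel_measurable_inner measurable_feature_sample) (auto dest: sample_mem)

lemma measurable_loss_deriv:
  "a \<in> measurable M \<rho> \<Longrightarrow> b \<in> borel_measurable M \<Longrightarrow>
    (\<lambda>w. \<phi>' (snd (a w)) (inner (b w) (\<Phi> (fst (a w))))) \<in> borel_measurable M"
  by (intro measurable_comp_restricted_uncurry[OF borel_measurable_derivative_family[OF phi_meas phi_deriv]]
      measurable_label_sample borel_measurable_inner measurable_feature_sample) (auto dest: sample_mem)

primrec iter_radius :: "nat \<Rightarrow> real" where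
  "iter_radius 0 = 0"
| "iter_radius (Suc t) =
     iter_radius t + \<eta> t * deriv_growth (feature_bound * iter_radius t) * feature_bound"

lemma iter_radius_nonneg: "0 \<le> iter_radius t"
proof (induction t)
  case (Suc t)
  have "0 \<le> \<eta> t * deriv_growth (feature_bound * iter_radius t) * feature_bound"
    using Suc eta_pos one_le_feature_bound
    by (intro mult_nonneg_nonneg deriv_growth_nonneg) (auto intro: less_imp_le)
  with Suc show ?case by simp
qed simp

lemma norm_ogd_le: "(\<And>k. k < t \<Longrightarrow> w k \<in> X \<times> Y) \<Longrightarrow> norm (ogd \<phi>' \<Phi> \<eta> w t) \<le> iter_radius t"
proof (induction t)
  case (Suc t)
  let ?f = "ogd \<phi>' \<Phi> \<eta> w t"
  obtain x y where xy: "w t = (x, y)" and x: "x \<in> X" and y: "y \<in> Y"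
    using Suc.prems[of t] by (cases "w t") auto
  have IH: "norm ?f \<le> iter_radius t" using Suc by simp
  have "\<bar>inner ?f (\<Phi> x)\<bar> \<le> feature_bound * iter_radius t"
    using abs_eval_le[OF x, of ?f] IH one_le_feature_bound by (smt (verit) mult_left_mono)
  then have "\<bar>\<phi>' y (inner ?f (\<Phi> x))\<bar> * norm (\<Phi> x) \<le> deriv_growth (feature_bound * iter_radius t) * feature_bound"
    using abs_deriv_le[OF y] norm_feature_le[OF x] deriv_growth_nonneg iter_radius_nonneg one_le_feature_bound
    by (intro mult_mono) auto
  then have "\<bar>\<eta> t * \<phi>' y (inner ?f (\<Phi> x))\<bar> * norm (\<Phi> x)
      \<le> \<eta> t * (deriv_growth (feature_bound * iter_radius t) * feature_bound)"
    using eta_pos by (simp add: abs_mult mult.assoc mult_left_mono less_imp_le)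
  then show ?case
    using IH xy norm_triangle_ineq4[of ?f "(\<eta> t * \<phi>' y (inner ?f (\<Phi> x))) *\<^sub>R \<Phi> x"] iter_radius_nonneg[of "Suc t"]
    by (auto simp: mult.assoc)
qed simp

lemma ogd_cong_prefix: "(\<And>k. k < t \<Longrightarrow> w k = w' k) \<Longrightarrow> ogd \<phi>' \<Phi> \<eta> w t = ogd \<phi>' \<Phi> \<eta> w' t"
  by (induction t) simp_all

lemma measurable_ogd_prefix:
  "t \<le> n \<Longrightarrow> (\<lambda>v. ogd \<phi>' \<Phi> \<eta> v t) \<in> borel_measurable (PiM {..<n} (\<lambda>_. \<rho>))"
proof (induction t)
  case (Suc t)
  have vt: "(\<lambda>v. v t) \<in> measurable (PiM {..<n} (\<lambda>_. \<rho>)) \<rho>"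
    using Suc.prems by (intro measurable_component_singleton) auto
  have IH: "(\<lambda>v. ogd \<phi>' \<Phi> \<eta> v t) \<in> borel_measurable (PiM {..<n} (\<lambda>_. \<rho>))"
    using Suc by simp
  have "(\<lambda>v. ogd \<phi>' \<Phi> \<eta> v t
      - (\<eta> t * \<phi>' (snd (v t)) (inner (ogd \<phi>' \<Phi> \<eta> v t) (\<Phi> (fst (v t))))) *\<^sub>R \<Phi> (fst (v t)))
    \<in> borel_measurable (PiM {..<n} (\<lambda>_. \<rho>))"
    by (intro borel_measurable_diff borel_measurable_scaleR borel_measurable_times borel_measurable_const
        IH measurable_loss_deriv[OF vt] measurable_feature_sample[OF vt])
  then show ?case by (simp cong: if_cong)
qed simp

sublocale P: prob_space P by (rule P_prob)
sublocale rho: prob_space \<rho> by (rule rho_prob)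

abbreviation iter :: "'w \<Rightarrow> nat \<Rightarrow> 'h" where
  "iter \<omega> t \<equiv> ogd \<phi>' \<Phi> \<eta> (\<lambda>k. Z k \<omega>) t"

definition past :: "nat \<Rightarrow> 'w \<Rightarrow> nat \<Rightarrow> 'a \<times> real" where
  "past t \<omega> = restrict (\<lambda>k. Z k \<omega>) {..<t}"

lemma Z_measurable: "Z k \<in> measurable P \<rho>"
  using Z_indep unfolding P.indep_vars_def2 by auto

lemma sample_mem_space: "\<omega> \<in> space P \<Longrightarrow> Z k \<omega> \<in> X \<times> Y"
  by (rule sample_mem[OF Z_measurable])

lemma measurable_past: "past t \<in> measurable P (PiM {..<t} (\<lambda>_. \<rho>))"
  unfolding past_def by (intro measurable_restrict Z_measurable)

lemma iter_eq_ogd_past: "iter \<omega> t = ogd \<phi>' \<Phi> \<eta> (past t \<omega>) t"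
  by (rule ogd_cong_prefix) (simp add: past_def)

lemma measurable_iter: "(\<lambda>\<omega>. iter \<omega> t) \<in> borel_measurable P"
  unfolding iter_eq_ogd_past by (rule measurable_compose[OF measurable_past measurable_ogd_prefix]) simp

lemma norm_iter_le: "\<omega> \<in> space P \<Longrightarrow> norm (iter \<omega> t) \<le> iter_radius t"
  by (rule norm_ogd_le) (rule sample_mem_space)

text \<open>Both variables of indep_var must have the same type, so the current sample is taken as a
  function on {t}.\<close>

lemma indep_past_sample:
  "prob_space.indep_var P (PiM {..<t} (\<lambda>_. \<rho>)) (past t) (PiM {t} (\<lambda>_. \<rho>)) (\<lambda>\<omega>. restrict (\<lambda>k. Z k \<omega>) {t})"
  unfolding past_def[abs_def] by (rule P.indep_var_restrict[OF Z_indep]) auto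

lemma integrable_loss: "integrable \<rho> (\<lambda>z. loss z f)"
  using loss_bounds[OF _ order_refl] space_rho
  by (intro rho.integrable_const_bound[where B="loss_sup (norm f)"] AE_I2
      measurable_loss[OF measurable_ident_sets[OF refl] borel_measurable_const]) auto

lemma nn_integral_loss: "(\<integral>\<^sup>+z. ennreal (loss z f) \<partial>\<rho>) = ennreal (gen_err \<rho> \<phi> \<Phi> f)"
  unfolding gen_err_def using loss_bounds[OF _ order_refl] space_rho
  by (intro nn_integral_eq_integral integrable_loss AE_I2) auto

lemma integrable_sample_loss:
  assumes "g \<in> borel_measurable P" and "\<And>\<omega>. \<omega> \<in> space P \<Longrightarrow> norm (g \<omega>) \<le> r"
  shows "integrable P (\<lambda>\<omega>. loss (Z t \<omega>) (g \<omega>))"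
proof (rule P.integrable_const_bound[where B="loss_sup r"])
  show "AE \<omega> in P. norm (loss (Z t \<omega>) (g \<omega>)) \<le> loss_sup r"
    using loss_bounds[OF sample_mem_space assms(2)] by (intro AE_I2) simp
  show "(\<lambda>\<omega>. loss (Z t \<omega>) (g \<omega>)) \<in> borel_measurable P"
    by (rule measurable_loss[OF Z_measurable assms(1)])
qed

lemma integral_sample_loss: "(\<integral>\<omega>. loss (Z t \<omega>) f \<partial>P) = gen_err \<rho> \<phi> \<Phi> f"
  using integral_distr[OF Z_measurable measurable_loss[OF measurable_ident_sets[OF refl] borel_measurable_const]]
  unfolding gen_err_def by (simp add: Z_distr)

lemma nn_integral_sample_loss:
  "(\<integral>\<^sup>+\<omega>. ennreal (loss (Z t \<omega>) f) \<partial>P) = ennreal (gen_err \<rho> \<phi> \<Phi> f)"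
proof -
  have "(\<lambda>z. ennreal (loss z f)) \<in> borel_measurable \<rho>"
    using measurable_loss[OF measurable_ident_sets[OF refl] borel_measurable_const] by simp
  then have "(\<integral>\<^sup>+\<omega>. ennreal (loss (Z t \<omega>) f) \<partial>P) = (\<integral>\<^sup>+z. ennreal (loss z f) \<partial>distr P \<rho> (Z t))"
    by (intro nn_integral_distr[symmetric, OF Z_measurable]) (simp add: Z_distr)
  then show ?thesis by (simp add: Z_distr nn_integral_loss)
qed

text \<open>The sample z_t is independent of the iterate f_t, so on average it sees the full
  generalization error of f_t, which is at least that of f_H.\<close>

lemma gen_err_le_expected_sample_loss: "gen_err \<rho> \<phi> \<Phi> fH \<le> (\<integral>\<omega>. loss (Z t \<omega>) (iter \<omega> t) \<partial>P)"
proof -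
  let ?Past = "PiM {..<t} (\<lambda>_. \<rho>)" and ?Now = "PiM {t} (\<lambda>_. \<rho>)"
  let ?now = "\<lambda>\<omega>. restrict (\<lambda>k. Z k \<omega>) {t}"
  have now_t: "(\<lambda>u. u t) \<in> measurable ?Now \<rho>"
    by (rule measurable_component_singleton) simp
  have h: "(\<lambda>(v, u). ennreal (loss (u t) (ogd \<phi>' \<Phi> \<eta> v t))) \<in> borel_measurable (?Past \<Otimes>\<^sub>M ?Now)"
    using measurable_loss[OF measurable_compose[OF measurable_snd now_t]
        measurable_compose[OF measurable_fst measurable_ogd_prefix[of t t]]]
    by (simp add: case_prod_beta')
  have now: "(\<integral>\<^sup>+u. ennreal (loss (u t) f) \<partial>distr P ?Now ?now) = ennreal (gen_err \<rho> \<phi> \<Phi> f)" for f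
  proof -
    have "(\<lambda>u. ennreal (loss (u t) f)) \<in> borel_measurable ?Now"
      using measurable_loss[OF now_t borel_measurable_const] by simp
    then have "(\<integral>\<^sup>+u. ennreal (loss (u t) f) \<partial>distr P ?Now ?now) = (\<integral>\<^sup>+\<omega>. ennreal (loss (Z t \<omega>) f) \<partial>P)"
      by (subst nn_integral_distr) (auto intro: measurable_restrict Z_measurable)
    then show ?thesis by (simp add: nn_integral_sample_loss)
  qed
  have nonneg: "0 \<le> loss (Z t \<omega>) (iter \<omega> t)" if "\<omega> \<in> space P" for \<omega>
    using loss_bounds[OF sample_mem_space[OF that] norm_iter_le[OF that]] by simp
  interpret Past: prob_space "distr P ?Past (past t)" by (rule P.prob_space_distr[OF measurable_past])
  have "ennreal (gen_err \<rho> \<phi> \<Phi> fH) = (\<integral>\<^sup>+v. ennreal (gen_err \<rho> \<phi> \<Phi> fH) \<partial>distr P ?Past (past t))"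
    using Past.emeasure_space_1 by simp
  also have "\<dots> \<le> (\<integral>\<^sup>+v. \<integral>\<^sup>+u. ennreal (loss (u t) (ogd \<phi>' \<Phi> \<eta> v t)) \<partial>distr P ?Now ?now \<partial>distr P ?Past (past t))"
    using fH_min by (intro nn_integral_mono) (simp add: now ennreal_leI)
  also have "\<dots> = (\<integral>\<^sup>+\<omega>. ennreal (loss (Z t \<omega>) (iter \<omega> t)) \<partial>P)"
    using P.nn_integral_indep_var[OF indep_past_sample h] by (simp add: iter_eq_ogd_past)
  also have "\<dots> = ennreal (\<integral>\<omega>. loss (Z t \<omega>) (iter \<omega> t) \<partial>P)"
    using nonneg
    by (intro nn_integral_eq_integral integrable_sample_loss[OF measurable_iter norm_iter_le] AE_I2) auto
  finally show ?thesis
    using nonneg by (subst (asm) ennreal_le_iff) (auto intro!: integral_nonneg_AE AE_I2)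
qed

definition noise_const :: real where
  "noise_const = feature_bound\<^sup>2 * self_bound_const * (1 + loss_bound)"

lemma noise_const_pos: "0 < noise_const"
  unfolding noise_const_def using one_le_feature_bound one_le_self_bound_const le_loss_bound(3) by simp

lemma dist_step_le:
  assumes x: "x \<in> X" and y: "y \<in> Y" and e: "0 \<le> e"
  shows "(norm (f - (e * \<phi>' y (inner f (\<Phi> x))) *\<^sub>R \<Phi> x - fH))\<^sup>2
    \<le> (norm (f - fH))\<^sup>2
       - (2 * e - e\<^sup>2 * feature_bound\<^sup>2 * self_bound_const) * (\<phi> y (inner f (\<Phi> x)) - \<phi> y (inner fH (\<Phi> x)))
       + e\<^sup>2 * noise_const"
proof -
  define s where "s = inner f (\<Phi> x)"
  define sH where "sH = inner fH (\<Phi> x)"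
  define g where "g = \<phi>' y s"
  let ?\<kappa> = feature_bound and ?A = self_bound_const
  have "f - (e * g) *\<^sub>R \<Phi> x - fH = (f - fH) - (e * g) *\<^sub>R \<Phi> x" by (simp add: algebra_simps)
  then have "(norm (f - (e * g) *\<^sub>R \<Phi> x - fH))\<^sup>2
      = (norm (f - fH))\<^sup>2 - 2 * (e * g) * inner (f - fH) (\<Phi> x) + (e * g)\<^sup>2 * (norm (\<Phi> x))\<^sup>2"
    by (simp only: norm_diff_scaleR_power2)
  also have "inner (f - fH) (\<Phi> x) = s - sH" by (simp add: s_def sH_def inner_diff_left)
  also have "(norm (f - fH))\<^sup>2 - 2 * (e * g) * (s - sH) + (e * g)\<^sup>2 * (norm (\<Phi> x))\<^sup>2
      = (norm (f - fH))\<^sup>2 - 2 * e * (g * (s - sH)) + e\<^sup>2 * (g\<^sup>2 * (norm (\<Phi> x))\<^sup>2)"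
    by (simp add: power_mult_distrib)
  also have "\<dots> \<le> (norm (f - fH))\<^sup>2 - 2 * e * (\<phi> y s - \<phi> y sH) + e\<^sup>2 * (?A * (1 + \<phi> y s) * ?\<kappa>\<^sup>2)"
  proof -
    have "2 * e * (\<phi> y s - \<phi> y sH) \<le> 2 * e * (g * (s - sH))"
      using loss_tangent[OF y, of s sH] e unfolding g_def by (intro mult_left_mono) (auto simp: algebra_simps)
    moreover have "g\<^sup>2 * (norm (\<Phi> x))\<^sup>2 \<le> ?A * (1 + \<phi> y s) * ?\<kappa>\<^sup>2"
      using deriv_sq_le_loss[OF y, of s] norm_feature_le[OF x] one_le_self_bound_const phi_nonneg y
      unfolding g_def
      by (intro mult_mono power_mono) auto
    then have "e\<^sup>2 * (g\<^sup>2 * (norm (\<Phi> x))\<^sup>2) \<le> e\<^sup>2 * (?A * (1 + \<phi> y s) * ?\<kappa>\<^sup>2)"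
      by (intro mult_left_mono) auto
    ultimately show ?thesis by linarith
  qed
  also have "\<dots> = (norm (f - fH))\<^sup>2 - (2 * e - e\<^sup>2 * ?\<kappa>\<^sup>2 * ?A) * (\<phi> y s - \<phi> y sH)
      + e\<^sup>2 * (?\<kappa>\<^sup>2 * ?A * (1 + \<phi> y sH))"
    by (simp add: algebra_simps)
  also have "\<dots> \<le> (norm (f - fH))\<^sup>2 - (2 * e - e\<^sup>2 * ?\<kappa>\<^sup>2 * ?A) * (\<phi> y s - \<phi> y sH)
      + e\<^sup>2 * (?\<kappa>\<^sup>2 * ?A * (1 + loss_bound))"
    using le_loss_bound(2)[OF x y] one_le_self_bound_const unfolding sH_def
    by (intro add_left_mono mult_left_mono) auto
  finally show ?thesis unfolding s_def sH_def g_def noise_const_def .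
qed

definition mse :: "nat \<Rightarrow> real" where
  "mse t = (\<integral>\<omega>. (norm (iter \<omega> t - fH))\<^sup>2 \<partial>P)"

lemma integrable_sq_dist: "integrable P (\<lambda>\<omega>. (norm (iter \<omega> t - fH))\<^sup>2)"
proof (rule P.integrable_const_bound[where B="(iter_radius t + norm fH)\<^sup>2"])
  have "norm (iter \<omega> t - fH) \<le> iter_radius t + norm fH" if "\<omega> \<in> space P" for \<omega>
    using norm_iter_le[OF that, of t] norm_triangle_ineq4[of "iter \<omega> t" fH] by linarith
  then show "AE \<omega> in P. norm ((norm (iter \<omega> t - fH))\<^sup>2) \<le> (iter_radius t + norm fH)\<^sup>2"
    by (intro AE_I2) (simp add: power_mono)
  show "(\<lambda>\<omega>. (norm (iter \<omega> t - fH))\<^sup>2) \<in> borel_measurable P"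
    using measurable_iter by measurable
qed

lemma nn_integral_sq_dist: "(\<integral>\<^sup>+\<omega>. ennreal ((norm (iter \<omega> t - fH))\<^sup>2) \<partial>P) = ennreal (mse t)"
  unfolding mse_def by (rule nn_integral_eq_integral[OF integrable_sq_dist]) auto

lemma mse_Suc_le:
  assumes t: "1 \<le> t" and small: "\<eta> t * feature_bound\<^sup>2 * self_bound_const \<le> 2"
  shows "mse (Suc t) \<le> mse t + noise_const * (\<eta> t)\<^sup>2"
proof -
  let ?c = "2 * \<eta> t - (\<eta> t)\<^sup>2 * feature_bound\<^sup>2 * self_bound_const"
  let ?excess = "\<lambda>\<omega>. loss (Z t \<omega>) (iter \<omega> t) - loss (Z t \<omega>) fH"
  have c: "0 \<le> ?c"
    using small eta_pos mult_left_mono[OF small, of "\<eta> t"] by (simp add: power2_eq_square algebra_simps)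
  have pointwise: "(norm (iter \<omega> (Suc t) - fH))\<^sup>2
      \<le> (norm (iter \<omega> t - fH))\<^sup>2 - ?c * ?excess \<omega> + (\<eta> t)\<^sup>2 * noise_const"
    if \<omega>: "\<omega> \<in> space P" for \<omega>
  proof -
    obtain x y where xy: "Z t \<omega> = (x, y)" and "x \<in> X" "y \<in> Y"
      using sample_mem_space[OF \<omega>, of t] by (cases "Z t \<omega>") auto
    then show ?thesis
      using dist_step_le[of x y "\<eta> t" "iter \<omega> t"] t less_imp_le[OF eta_pos[rule_format]]
      by (simp add: mult.commute)
  qed
  have int_iter: "integrable P (\<lambda>\<omega>. loss (Z t \<omega>) (iter \<omega> t))"
    by (rule integrable_sample_loss[OF measurable_iter norm_iter_le])
  have int_fH: "integrable P (\<lambda>\<omega>. loss (Z t \<omega>) fH)"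
    by (rule integrable_sample_loss[where r="norm fH"]) auto
  have "mse (Suc t) \<le> (\<integral>\<omega>. (norm (iter \<omega> t - fH))\<^sup>2 - ?c * ?excess \<omega> + (\<eta> t)\<^sup>2 * noise_const \<partial>P)"
    unfolding mse_def using pointwise int_iter int_fH
    by (intro integral_mono integrable_sq_dist) (auto intro!: Bochner_Integration.integrable_add
        Bochner_Integration.integrable_diff integrable_mult_right integrable_sq_dist)
  also have "\<dots> = mse t - ?c * ((\<integral>\<omega>. loss (Z t \<omega>) (iter \<omega> t) \<partial>P) - gen_err \<rho> \<phi> \<Phi> fH) + (\<eta> t)\<^sup>2 * noise_const"
    unfolding mse_def using int_iter int_fH
    by (simp add: integrable_sq_dist integral_sample_loss Bochner_Integration.integrable_diff P.prob_space)
  also have "\<dots> \<le> mse t + noise_const * (\<eta> t)\<^sup>2"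
    using gen_err_le_expected_sample_loss[of t] c by (simp add: mult_nonneg_nonneg)
  finally show ?thesis .
qed

lemma mse_bounded: "\<exists>C\<ge>0. \<forall>t\<ge>1. mse t \<le> C + noise_const * (\<Sum>k=1..t. (\<eta> k)\<^sup>2)"
proof (rule le_partial_sums_if_eventually_increments)
  have \<kappa>A: "0 < feature_bound\<^sup>2 * self_bound_const"
    using one_le_feature_bound one_le_self_bound_const by simp
  have "eventually (\<lambda>t. \<eta> t < 2 / (feature_bound\<^sup>2 * self_bound_const)) sequentially"
    using order_tendstoD(2)[OF eta_lim] \<kappa>A by simp
  with eventually_ge_at_top[of 1]
  show "eventually (\<lambda>t. mse (Suc t) \<le> mse t + noise_const * (\<eta> t)\<^sup>2) sequentially"
  proof eventually_elim
    case (elim t)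
    then show ?case using \<kappa>A by (intro mse_Suc_le) (auto simp: pos_less_divide_eq mult.assoc)
  qed
  show "0 \<le> noise_const" using noise_const_pos by simp
qed simp

lemma integrable_loss_grad: "integrable \<rho> (\<lambda>z. \<phi>' (snd z) (inner f (\<Phi> (fst z))) *\<^sub>R \<Phi> (fst z))"
proof (rule integrableI_bounded_complete)
  let ?B = "deriv_growth (feature_bound * norm f) * feature_bound"
  have "norm (\<phi>' (snd z) (inner f (\<Phi> (fst z))) *\<^sub>R \<Phi> (fst z)) \<le> ?B" if "z \<in> space \<rho>" for z
  proof -
    have x: "fst z \<in> X" and y: "snd z \<in> Y" using that space_rho by (auto simp: mem_Times_iff)
    show ?thesis
      using abs_deriv_le[OF y abs_eval_le[OF x]] norm_feature_le[OF x] deriv_growth_nonneg one_le_feature_bound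
      by (auto intro!: mult_mono)
  qed
  then have "(\<integral>\<^sup>+z. norm (\<phi>' (snd z) (inner f (\<Phi> (fst z))) *\<^sub>R \<Phi> (fst z)) \<partial>\<rho>) \<le> (\<integral>\<^sup>+z. ?B \<partial>\<rho>)"
    by (intro nn_integral_mono) (simp add: ennreal_leI)
  also have "\<dots> < \<infinity>" by (simp add: rho.emeasure_space_1)
  finally show "(\<integral>\<^sup>+z. norm (\<phi>' (snd z) (inner f (\<Phi> (fst z))) *\<^sub>R \<Phi> (fst z)) \<partial>\<rho>) < \<infinity>" .
  show "(\<lambda>z. \<phi>' (snd z) (inner f (\<Phi> (fst z))) *\<^sub>R \<Phi> (fst z)) \<in> borel_measurable \<rho>"
    by (intro borel_measurable_scaleR measurable_loss_deriv[OF measurable_ident_sets[OF refl] borel_measurable_const]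
        measurable_feature_sample[OF measurable_ident_sets[OF refl]])
qed

text \<open>Convexity of the pointwise loss, integrated over \<rho>, makes the gradient a subgradient of
  the generalization error.\<close>

lemma excess_risk_le: "gen_err \<rho> \<phi> \<Phi> f - gen_err \<rho> \<phi> \<Phi> fH \<le> norm (grad_err \<rho> \<phi>' \<Phi> f) * norm (f - fH)"
proof -
  have inner_grad: "has_bochner_integral \<rho> (\<lambda>z. inner (\<phi>' (snd z) (inner f (\<Phi> (fst z))) *\<^sub>R \<Phi> (fst z)) (f - fH))
      (inner (grad_err \<rho> \<phi>' \<Phi> f) (f - fH))"
    unfolding grad_err_def
    by (intro has_bochner_integral_inner_left has_bochner_integral_integrable integrable_loss_grad)
  have "gen_err \<rho> \<phi> \<Phi> f - gen_err \<rho> \<phi> \<Phi> fH = (\<integral>z. loss z f - loss z fH \<partial>\<rho>)"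
    unfolding gen_err_def by (simp add: integrable_loss)
  also have "\<dots> \<le> (\<integral>z. inner (\<phi>' (snd z) (inner f (\<Phi> (fst z))) *\<^sub>R \<Phi> (fst z)) (f - fH) \<partial>\<rho>)"
  proof (rule integral_mono)
    fix z assume "z \<in> space \<rho>"
    then have "snd z \<in> Y" using space_rho by (auto simp: mem_Times_iff)
    from loss_tangent[OF this, of "inner f (\<Phi> (fst z))" "inner fH (\<Phi> (fst z))"]
    show "loss z f - loss z fH \<le> inner (\<phi>' (snd z) (inner f (\<Phi> (fst z))) *\<^sub>R \<Phi> (fst z)) (f - fH)"
      by (simp add: inner_diff_right inner_commute[of "\<Phi> (fst z)"] algebra_simps)
  qed (use integrable_loss integrable.intros[OF inner_grad] in auto)
  also have "\<dots> = inner (grad_err \<rho> \<phi>' \<Phi> f) (f - fH)"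
    by (rule has_bochner_integral_integral_eq[OF inner_grad])
  also have "\<dots> \<le> norm (grad_err \<rho> \<phi>' \<Phi> f) * norm (f - fH)"
    by (rule order_trans[OF abs_ge_self Cauchy_Schwarz_ineq2])
  finally show ?thesis .
qed

lemma measurable_gen_err_iter: "(\<lambda>\<omega>. gen_err \<rho> \<phi> \<Phi> (iter \<omega> t)) \<in> borel_measurable P"
proof -
  have "(\<lambda>(v, z). loss z (ogd \<phi>' \<Phi> \<eta> v t)) \<in> borel_measurable (PiM {..<t} (\<lambda>_. \<rho>) \<Otimes>\<^sub>M \<rho>)"
    using measurable_loss[OF measurable_snd measurable_compose[OF measurable_fst measurable_ogd_prefix[of t t]]]
    by (simp add: case_prod_beta')
  then have "(\<lambda>v. gen_err \<rho> \<phi> \<Phi> (ogd \<phi>' \<Phi> \<eta> v t)) \<in> borel_measurable (PiM {..<t} (\<lambda>_. \<rho>))"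
    unfolding gen_err_def by (rule rho.borel_measurable_lebesgue_integral)
  from measurable_compose[OF measurable_past this] show ?thesis
    unfolding iter_eq_ogd_past .
qed

lemma excess_risk_sq_le:
  "(\<integral>\<^sup>+\<omega>. ennreal (gen_err \<rho> \<phi> \<Phi> (iter \<omega> t) - gen_err \<rho> \<phi> \<Phi> fH) \<partial>P)\<^sup>2
    \<le> (\<integral>\<^sup>+\<omega>. ennreal ((norm (iter \<omega> t - fH))\<^sup>2) \<partial>P)
       * (\<integral>\<^sup>+\<omega>. ennreal ((norm (grad_err \<rho> \<phi>' \<Phi> (iter \<omega> t)))\<^sup>2) \<partial>P)"
  by (intro nn_integral_sq_le_of_le_mult excess_risk_le norm_ge_zero
      borel_measurable_diff[OF measurable_gen_err_iter borel_measurable_const]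
      measurable_compose[OF borel_measurable_diff[OF measurable_iter borel_measurable_const] borel_measurable_norm])

end

theorem lemma4:
  fixes X :: "'a::euclidean_space set" and Y :: "real set"
    and \<rho> :: "('a \<times> real) measure"
    and \<Phi> :: "'a \<Rightarrow> 'h::{real_inner, complete_space, second_countable_topology}"
    and \<phi> \<phi>' :: "real \<Rightarrow> real \<Rightarrow> real"
    and fH :: 'h and \<eta> :: "nat \<Rightarrow> real" and \<alpha> L :: real
    and P :: "'w measure" and Z :: "nat \<Rightarrow> 'w \<Rightarrow> 'a \<times> real"
  assumes rho_prob: "prob_space \<rho>"
    and rho_sets: "sets \<rho> = sets (restrict_space borel (X \<times> Y))"
    and K_cont: "continuous_on (X \<times> X) (\<lambda>p. inner (\<Phi> (fst p)) (\<Phi> (snd p)))"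
    and K_dense: "closure (span (\<Phi> ` X)) = UNIV"
    and kappa: "\<exists>\<kappa>. \<forall>x\<in>X. norm (\<Phi> x) \<le> \<kappa>"
    and phi_meas: "(\<lambda>p. \<phi> (fst p) (snd p)) \<in> borel_measurable (restrict_space borel (Y \<times> UNIV))"
    and phi_nonneg: "\<forall>y\<in>Y. \<forall>s. 0 \<le> \<phi> y s"
    and phi_deriv: "\<forall>y\<in>Y. \<forall>s. (\<phi> y has_real_derivative \<phi>' y s) (at s)"
    and phi_convex: "\<forall>y\<in>Y. convex_on UNIV (\<phi> y)"
    and alpha: "0 < \<alpha>" "\<alpha> \<le> 1" and L: "0 < L"
    and holder: "\<forall>y\<in>Y. \<forall>s s'. \<bar>\<phi>' y s - \<phi>' y s'\<bar> \<le> L * \<bar>s - s'\<bar> powr \<alpha>"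
    and fH_min: "\<forall>f. gen_err \<rho> \<phi> \<Phi> fH \<le> gen_err \<rho> \<phi> \<Phi> f"
    and bounded: "\<exists>B. (\<forall>y\<in>Y. \<phi> y 0 \<le> B) \<and> (\<forall>x\<in>X. \<forall>y\<in>Y. \<phi> y (inner fH (\<Phi> x)) \<le> B)"
    and P_prob: "prob_space P"
    and Z_indep: "prob_space.indep_vars P (\<lambda>_. \<rho>) Z UNIV"
    and Z_distr: "\<forall>t. distr P \<rho> (Z t) = \<rho>"
    and eta_pos: "\<forall>t. 0 < \<eta> t"
    and eta_lim: "\<eta> \<longlonglongrightarrow> 0"
  shows "\<exists>C \<gamma>. 0 < C \<and> 0 < \<gamma> \<and>
    (\<forall>t\<ge>1.
      (\<integral>\<^sup>+\<omega>. ennreal ((norm (ogd \<phi>' \<Phi> \<eta> (\<lambda>k. Z k \<omega>) t - fH))\<^sup>2) \<partial>P)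
        \<le> ennreal (C + \<gamma> * (\<Sum>k=1..t. (\<eta> k)\<^sup>2))
      \<and> (\<integral>\<^sup>+\<omega>. ennreal (gen_err \<rho> \<phi> \<Phi> (ogd \<phi>' \<Phi> \<eta> (\<lambda>k. Z k \<omega>) t) - gen_err \<rho> \<phi> \<Phi> fH) \<partial>P)\<^sup>2
        \<le> ennreal (C + \<gamma> * (\<Sum>k=1..t. (\<eta> k)\<^sup>2))
           * (\<integral>\<^sup>+\<omega>. ennreal ((norm (grad_err \<rho> \<phi>' \<Phi> (ogd \<phi>' \<Phi> \<eta> (\<lambda>k. Z k \<omega>) t)))\<^sup>2) \<partial>P))"
proof -
  interpret ogd_setting X Y \<rho> \<Phi> \<phi> \<phi>' fH \<eta> \<alpha> L P Z
    unfolding ogd_setting_def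
    by (intro conjI rho_prob rho_sets K_cont kappa phi_meas phi_nonneg phi_deriv phi_convex alpha L
        holder fH_min bounded P_prob Z_indep Z_distr eta_pos eta_lim)
  obtain C where C: "0 \<le> C" "\<And>t. 1 \<le> t \<Longrightarrow> mse t \<le> C + noise_const * (\<Sum>k=1..t. (\<eta> k)\<^sup>2)"
    using mse_bounded by blast
  have mse_le: "(\<integral>\<^sup>+\<omega>. ennreal ((norm (iter \<omega> t - fH))\<^sup>2) \<partial>P) \<le> ennreal (C + 1 + noise_const * (\<Sum>k=1..t. (\<eta> k)\<^sup>2))"
    if "1 \<le> t" for t
    using C(2)[OF that] by (simp add: nn_integral_sq_dist ennreal_leI)
  show ?thesis
    using C(1) noise_const_pos mse_le order_trans[OF excess_risk_sq_le mult_right_mono[OF mse_le]]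
    by (intro exI[of _ "C + 1"] exI[of _ noise_const]) auto
qed

end
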